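(* The set $\mathcal{L}_{4,2}\subseteq\mathbb{R}^2$ is the basic semialgebraic set consisting of all $(s,t)\in\mathbb{R}^2$ satisfying $$2+s+t\ge 0,\qquad 1+2s+2t+st\ge 0,\qquad (1+2s+2t+st)^2\ge 4st.$$
   Context: $\mathcal{S}^{4,2}$ is the set of real symmetric $4\times 4$ matrices all of whose $2\times 2$ principal submatrices are positive semidefinite. $\lambda(\mathcal{S}^{4,2})$ is the set of all $(\lambda_1,\dots,\lambda_4)\in\mathbb{R}^4$ such that some $X\in\mathcal{S}^{4,2}$ is similar to $\operatorname{diag}(\lambda_1,\dots,\lambda_4)$. $\mathcal{L}_{4,2}:=\{(s,t)\in\mathbb{R}^2 : (1,1,s,t)\in\lambda(\mathcal{S}^{4,2})\}$. *)

theory Defs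
  imports "Jordan_Normal_Form.DL_Submatrix"
begin

definition symmetric_real_mats :: "nat \<Rightarrow> real mat set" where
  "symmetric_real_mats n = {X \<in> carrier_mat n n. transpose_mat X = X}"

definition positive_semidefinite :: "real mat \<Rightarrow> bool" where
  "positive_semidefinite A \<longleftrightarrow>
     A \<in> symmetric_real_mats (dim_row A) \<and>
     (\<forall>v \<in> carrier_vec (dim_row A). v \<bullet> (A *\<^sub>v v) \<ge> 0)"

(* Rows and columns are numbered from 0. The principal submatrices of size k are
   those obtained by keeping the same k row and column indices. *)
definition locally_psd_mats :: "nat \<Rightarrow> nat \<Rightarrow> real mat set" where
  "locally_psd_mats n k =
     {X \<in> symmetric_real_mats n.
        \<forall>I. I \<subseteq> {..<n} \<and> card I = k \<longrightarrow> positive_semidefinite (submatrix X I I)}"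

(* Eigenvalues are listed with multiplicity and in any order. *)
definition eigenvalue_vectors :: "nat \<Rightarrow> real mat set \<Rightarrow> real vec set" where
  "eigenvalue_vectors n M =
     {l \<in> carrier_vec n. \<exists>X \<in> M. similar_mat X (mat_diag n (\<lambda>i. l $ i))}"

definition L_4_2 :: "(real \<times> real) set" where
  "L_4_2 = {(s, t). vec_of_list [1, 1, s, t] \<in> eigenvalue_vectors 4 (locally_psd_mats 4 2)}"

end

theory Submission
  imports Defs "Jordan_Normal_Form.Determinant"
begin

text \<open>
Write $d_{ij}$ for the principal $2 \times 2$ minors of $X \in \mathcal{S}^{4,2}$ and $e_2$ for their
sum. If $X$ has the eigenvalues $1,1,s,t$, then $2+s+t$ is its trace,
$1+2s+2t+st$ is $e_2$ and $st$ is its determinant. So the first two inequalities only say that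
diagonal entries and principal $2 \times 2$ minors are nonnegative, and the third one reads
$e_2^2 \ge 4 \det X$. That inequality holds on all of $\mathcal{S}^{4,2}$, because
\[ \det X \le d_{01} d_{23} + d_{02} d_{13} + d_{03} d_{12}, \]
each term on the right being at most a quarter of the square of the corresponding $d_{ij} + d_{kl}$
(\<open>det_le_sum_complementary_minors\<close>, \<open>det_le_square_sum_minors\<close>). To see the displayed
inequality, scale the diagonal to $1$, so that the other entries lie in $[-1,1]$. The difference of
the two sides is affine in each single off-diagonal entry, hence it is smallest when that entry is
$\pm 1$. Two opposite entries equal to $1$ leave the Lorentz product of two vectors in the forward
cone of the Minkowski plane, which is nonnegative (\<open>sum_triangles_le\<close>).

For the converse, adding a positive semidefinite matrix does not leave $\mathcal{S}^{4,2}$, so that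
eigenvalues may be raised while keeping the eigenvectors (\<open>locally_psd_raise_eigenvalues\<close>). Hence
only the points on the lower boundary of the region have to be realised. Where $s \ge 0$ this
boundary is $e_2 = 0$: all principal $2 \times 2$ minors of a realising matrix vanish, which
determines it up to signs by its diagonal (\<open>L_4_2_above_vanishing_minors\<close>). Where $s = -p^2$ and
$t = -q^2$ are negative, $e_2 \ge 2pq$ is the same as $(\sqrt 2 - p)(\sqrt 2 - q) \ge 1$, and the
boundary has the parametrisation $p = \sqrt 2 (1 - \alpha)$, $q = \sqrt 2 (1 - \beta)$ with
$2 \alpha \beta = 1$. There, equality in the bounds above forces
$d_{01} = d_{12} = d_{23} = d_{03} = 0$ up to numbering, which suggests the matrix in
\<open>L_4_2_above_negative\<close>.
\<close>

section \<open>Locally positive semidefinite matrices\<close>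

lemma binary_form_nonneg_iff:
  fixes a b c :: real
  shows "(\<forall>x y. 0 \<le> a * x\<^sup>2 + 2 * b * x * y + c * y\<^sup>2) \<longleftrightarrow> 0 \<le> a \<and> 0 \<le> c \<and> b\<^sup>2 \<le> a * c"
proof
  assume nonneg: "\<forall>x y. 0 \<le> a * x\<^sup>2 + 2 * b * x * y + c * y\<^sup>2"
  have a: "0 \<le> a" and c: "0 \<le> c"
    using nonneg[rule_format, of 1 0] nonneg[rule_format, of 0 1] by auto
  have "b\<^sup>2 \<le> a * c"
  proof (cases "a = 0 \<and> c = 0")
    case True
    then show ?thesis
      using nonneg[rule_format, of 1 1] nonneg[rule_format, of 1 "-1"] by auto
  next
    case False
    have "0 \<le> a * (a * c - b\<^sup>2)"
      using nonneg[rule_format, of "-b" a] by (simp add: algebra_simps power2_eq_square)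
    moreover have "0 \<le> c * (a * c - b\<^sup>2)"
      using nonneg[rule_format, of c "-b"] by (simp add: algebra_simps power2_eq_square)
    ultimately show ?thesis
      using False a c by (auto simp: zero_le_mult_iff)
  qed
  with a c show "0 \<le> a \<and> 0 \<le> c \<and> b\<^sup>2 \<le> a * c" by blast
next
  assume minors: "0 \<le> a \<and> 0 \<le> c \<and> b\<^sup>2 \<le> a * c"
  show "\<forall>x y. 0 \<le> a * x\<^sup>2 + 2 * b * x * y + c * y\<^sup>2"
  proof (intro allI)
    fix x y :: real
    have "a * (a * x\<^sup>2 + 2 * b * x * y + c * y\<^sup>2) = (a * x + b * y)\<^sup>2 + (a * c - b\<^sup>2) * y\<^sup>2"
      by (simp add: algebra_simps power2_eq_square)
    then have "0 \<le> a * (a * x\<^sup>2 + 2 * b * x * y + c * y\<^sup>2)"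
      using minors by simp
    then show "0 \<le> a * x\<^sup>2 + 2 * b * x * y + c * y\<^sup>2"
      using minors by (cases "a = 0") (auto simp: zero_le_mult_iff)
  qed
qed

lemma submatrix_pair:
  assumes "X \<in> carrier_mat n n" and "i < j" and "j < n"
  shows "submatrix X {i, j} {i, j} =
    mat 2 2 (\<lambda>(k, l). X $$ (if k = 0 then i else j, if l = 0 then i else j))"
proof -
  have pick0: "pick {i, j} 0 = i"
    using assms(2) by (auto intro!: Least_equality)
  have "(LEAST a. a \<in> {i, j} \<and> i < a) = j"
    using assms(2) by (auto intro!: Least_equality)
  then have pick1: "pick {i, j} (Suc 0) = j"
    using pick0 by simp
  have "{k. k < n \<and> k \<in> {i, j}} = {i, j}"
    using assms by auto
  then have "card {k. k < n \<and> k \<in> {i, j}} = 2"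
    using assms(2) by simp
  then show ?thesis
    using assms(1) pick0 pick1
    by (auto simp: submatrix_def less_2_cases_iff simp del: pick.simps intro!: eq_matI)
qed

lemma locally_psd_mats_2_iff:
  "X \<in> locally_psd_mats n 2 \<longleftrightarrow> X \<in> symmetric_real_mats n \<and>
    (\<forall>i j. i < j \<and> j < n \<longrightarrow>
      0 \<le> X $$ (i, i) \<and> 0 \<le> X $$ (j, j) \<and> (X $$ (i, j))\<^sup>2 \<le> X $$ (i, i) * X $$ (j, j))"
proof (cases "X \<in> symmetric_real_mats n")
  case True
  then have carrier: "X \<in> carrier_mat n n" and "transpose_mat X = X"
    by (auto simp: symmetric_real_mats_def)
  then have sym: "X $$ (i, j) = X $$ (j, i)" if "i < n" "j < n" for i j
    using that by (metis carrier_matD index_transpose_mat(1))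
  have psd: "positive_semidefinite (submatrix X {i, j} {i, j}) \<longleftrightarrow>
      0 \<le> X $$ (i, i) \<and> 0 \<le> X $$ (j, j) \<and> (X $$ (i, j))\<^sup>2 \<le> X $$ (i, i) * X $$ (j, j)"
    if "i < j" "j < n" for i j
  proof -
    let ?S = "mat 2 2 (\<lambda>(k, l). X $$ (if k = 0 then i else j, if l = 0 then i else j))"
    have form: "v \<bullet> (?S *\<^sub>v v) =
        X $$ (i, i) * (v $ 0)\<^sup>2 + 2 * X $$ (i, j) * v $ 0 * v $ 1 + X $$ (j, j) * (v $ 1)\<^sup>2"
      if "v \<in> carrier_vec 2" for v
      using that sym[of i j] \<open>i < j\<close> \<open>j < n\<close>
      by (simp add: scalar_prod_def numeral_2_eq_2 algebra_simps power2_eq_square)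
    have "positive_semidefinite ?S \<longleftrightarrow> (\<forall>v \<in> carrier_vec 2. 0 \<le> v \<bullet> (?S *\<^sub>v v))"
      using sym[of i j] that
      by (auto simp: positive_semidefinite_def symmetric_real_mats_def intro!: eq_matI)
    also have "\<dots> \<longleftrightarrow> (\<forall>x y. 0 \<le> X $$ (i, i) * x\<^sup>2 + 2 * X $$ (i, j) * x * y + X $$ (j, j) * y\<^sup>2)"
    proof (intro iffI allI ballI)
      fix x y :: real
      assume nonneg: "\<forall>v \<in> carrier_vec 2. 0 \<le> v \<bullet> (?S *\<^sub>v v)"
      have v: "vec_of_list [x, y] \<in> carrier_vec 2"
        by (rule carrier_vecI) simp
      show "0 \<le> X $$ (i, i) * x\<^sup>2 + 2 * X $$ (i, j) * x * y + X $$ (j, j) * y\<^sup>2"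
        using nonneg[rule_format, OF v] unfolding form[OF v] by (simp add: vec_of_list_index)
    qed (simp add: form)
    finally show ?thesis
      using submatrix_pair[OF carrier that] by (simp add: binary_form_nonneg_iff)
  qed
  have "(\<forall>I. I \<subseteq> {..<n} \<and> card I = 2 \<longrightarrow> P I) \<longleftrightarrow> (\<forall>i j. i < j \<and> j < n \<longrightarrow> P {i, j})"
    for P :: "nat set \<Rightarrow> bool"
  proof (intro iffI allI impI)
    fix I assume pairs: "\<forall>i j. i < j \<and> j < n \<longrightarrow> P {i, j}" and I: "I \<subseteq> {..<n} \<and> card I = 2"
    then obtain i j where ij: "I = {i, j}" "i \<noteq> j"
      by (auto simp: card_2_iff)
    with I have "i < n" "j < n" by auto
    then show "P I"
      using pairs[rule_format, of i j] pairs[rule_format, of j i] ij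
      by (cases i j rule: linorder_cases) (auto simp: insert_commute)
  qed auto
  then show ?thesis
    using True psd by (simp add: locally_psd_mats_def)
qed (simp add: locally_psd_mats_def)

lemma locally_psd_matsD:
  assumes "X \<in> locally_psd_mats n k"
  shows "X \<in> carrier_mat n n" and "transpose_mat X = X"
    and "i < n \<Longrightarrow> j < n \<Longrightarrow> X $$ (i, j) = X $$ (j, i)"
proof -
  show "X \<in> carrier_mat n n" and "transpose_mat X = X"
    using assms by (auto simp: locally_psd_mats_def symmetric_real_mats_def)
  then show "i < n \<Longrightarrow> j < n \<Longrightarrow> X $$ (i, j) = X $$ (j, i)"
    by (metis carrier_matD index_transpose_mat(1))
qed

lemma locally_psd_diag_nonneg:
  assumes X: "X \<in> locally_psd_mats n 2" and "2 \<le> n" "i < n"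
  shows "0 \<le> X $$ (i, i)"
proof (cases "i = 0")
  case True
  then have "i < 1 \<and> 1 < n" using assms by simp
  then show ?thesis using X unfolding locally_psd_mats_2_iff by blast
next
  case False
  then have "0 < i \<and> i < n" using assms by simp
  then show ?thesis using X unfolding locally_psd_mats_2_iff by blast
qed

lemma L_4_2_iff:
  "(s, t) \<in> L_4_2 \<longleftrightarrow>
    (\<exists>X \<in> locally_psd_mats 4 2. similar_mat X (mat_diag 4 (\<lambda>k. [1, 1, s, t] ! k)))"
proof -
  have "vec_of_list [1, 1, s, t] \<in> carrier_vec 4"
    by (rule carrier_vecI) simp
  then show ?thesis
    unfolding L_4_2_def eigenvalue_vectors_def mem_Collect_eq case_prod_conv vec_of_list_index
    by blast
qed

section \<open>Raising eigenvalues\<close>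

text \<open>
The eigenvectors are not normalised, so that explicit families can be given without square roots of
their norms; the inverse of the matrix with columns \<open>p k\<close> is its transpose with rows divided by the
squared norms.
\<close>

lemma similar_mat_diag_of_orthogonal_eigenvectors:
  fixes X :: "real mat" and p :: "nat \<Rightarrow> nat \<Rightarrow> real"
  assumes X: "X \<in> carrier_mat n n"
    and orth: "\<And>k m. k < n \<Longrightarrow> m < n \<Longrightarrow> k \<noteq> m \<Longrightarrow> (\<Sum>i<n. p k i * p m i) = 0"
    and nonzero: "\<And>k. k < n \<Longrightarrow> (\<Sum>i<n. (p k i)\<^sup>2) \<noteq> 0"
    and eigen: "\<And>i k. i < n \<Longrightarrow> k < n \<Longrightarrow> (\<Sum>j<n. X $$ (i, j) * p k j) = l k * p k i"
  shows "similar_mat X (mat_diag n l)"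
proof -
  let ?P = "mat n n (\<lambda>(i, k). p k i)"
  let ?Q = "mat n n (\<lambda>(k, i). p k i / (\<Sum>i<n. (p k i)\<^sup>2))"
  have QP: "?Q * ?P = 1\<^sub>m n"
  proof (rule eq_matI)
    fix k m assume "k < dim_row (1\<^sub>m n :: real mat)" "m < dim_col (1\<^sub>m n :: real mat)"
    then have km: "k < n" "m < n" by auto
    then have "(?Q * ?P) $$ (k, m) = (\<Sum>i<n. p k i * p m i) / (\<Sum>i<n. (p k i)\<^sup>2)"
      by (simp add: scalar_prod_def sum_divide_distrib atLeast0LessThan)
    then show "(?Q * ?P) $$ (k, m) = 1\<^sub>m n $$ (k, m)"
      using km orth[of k m] nonzero[of k] by (auto simp: power2_eq_square)
  qed auto
  then have PQ: "?P * ?Q = 1\<^sub>m n"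
    by (rule mat_mult_left_right_inverse[rotated 2]) auto
  have "X * ?P = ?P * mat_diag n l"
  proof (rule eq_matI)
    fix i k assume "i < dim_row (?P * mat_diag n l)" "k < dim_col (?P * mat_diag n l)"
    then have ik: "i < n" "k < n" by (auto simp: mat_diag_def)
    then show "(X * ?P) $$ (i, k) = (?P * mat_diag n l) $$ (i, k)"
      using X eigen[OF ik] by (simp add: mat_diag_mult_right[of _ n] scalar_prod_def atLeast0LessThan)
  qed (use X in \<open>auto simp: mat_diag_def\<close>)
  then have "?P * mat_diag n l * ?Q = X * ?P * ?Q"
    by simp
  also have "\<dots> = X * (?P * ?Q)"
    using X by (intro assoc_mult_mat[of _ n n _ n _ n]) auto
  finally have "X = ?P * mat_diag n l * ?Q"
    using X PQ by simp
  then show ?thesis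
    using X PQ QP by (intro similar_matI[of _ _ ?P ?Q n]) auto
qed

text \<open>
The increments \<open>l' k - l k\<close> are added along the eigenvectors. This is a positive semidefinite
perturbation: it adds a sum of squares to each of the binary forms that belong to the principal
$2 \times 2$ submatrices.
\<close>

lemma locally_psd_raise_eigenvalues:
  fixes X :: "real mat" and p :: "nat \<Rightarrow> nat \<Rightarrow> real"
  assumes X: "X \<in> locally_psd_mats n 2"
    and orth: "\<And>k m. k < n \<Longrightarrow> m < n \<Longrightarrow> k \<noteq> m \<Longrightarrow> (\<Sum>i<n. p k i * p m i) = 0"
    and nonzero: "\<And>k. k < n \<Longrightarrow> (\<Sum>i<n. (p k i)\<^sup>2) \<noteq> 0"
    and eigen: "\<And>i k. i < n \<Longrightarrow> k < n \<Longrightarrow> (\<Sum>j<n. X $$ (i, j) * p k j) = l k * p k i"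
    and le: "\<And>k. k < n \<Longrightarrow> l k \<le> l' k"
  shows "\<exists>Y \<in> locally_psd_mats n 2. similar_mat Y (mat_diag n l')"
proof -
  define N where "N k = (\<Sum>i<n. (p k i)\<^sup>2)" for k
  define c where "c k = (l' k - l k) / N k" for k
  have c: "0 \<le> c k" if "k < n" for k
    using le[OF that] by (simp add: c_def N_def sum_nonneg)
  define Y where "Y = mat n n (\<lambda>(i, j). X $$ (i, j) + (\<Sum>k<n. c k * p k i * p k j))"
  have sym: "X $$ (i, j) = X $$ (j, i)" if "i < n" "j < n" for i j
    using locally_psd_matsD(3)[OF X that] .
  have "Y \<in> locally_psd_mats n 2"
    unfolding locally_psd_mats_2_iff
  proof (intro conjI[of "Y \<in> _"] allI impI)
    show "Y \<in> symmetric_real_mats n"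
      by (auto simp: symmetric_real_mats_def Y_def sym mult.commute mult.left_commute intro!: eq_matI)
  next
    fix i j assume ij: "i < j \<and> j < n"
    have "0 \<le> Y $$ (i, i) * x\<^sup>2 + 2 * Y $$ (i, j) * x * y + Y $$ (j, j) * y\<^sup>2" for x y
    proof -
      have "Y $$ (i, i) * x\<^sup>2 + 2 * Y $$ (i, j) * x * y + Y $$ (j, j) * y\<^sup>2 =
          (X $$ (i, i) * x\<^sup>2 + 2 * X $$ (i, j) * x * y + X $$ (j, j) * y\<^sup>2) +
          (\<Sum>k<n. c k * (p k i * x + p k j * y)\<^sup>2)"
        using ij by (simp add: Y_def algebra_simps power2_eq_square sum.distrib sum_distrib_left)
      moreover have "0 \<le> (\<Sum>k<n. c k * (p k i * x + p k j * y)\<^sup>2)"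
        using c by (intro sum_nonneg) auto
      moreover have "0 \<le> X $$ (i, i) * x\<^sup>2 + 2 * X $$ (i, j) * x * y + X $$ (j, j) * y\<^sup>2"
        using X ij binary_form_nonneg_iff unfolding locally_psd_mats_2_iff by blast
      ultimately show ?thesis by linarith
    qed
    then show "0 \<le> Y $$ (i, i) \<and> 0 \<le> Y $$ (j, j) \<and> (Y $$ (i, j))\<^sup>2 \<le> Y $$ (i, i) * Y $$ (j, j)"
      using binary_form_nonneg_iff by blast
  qed
  moreover have "similar_mat Y (mat_diag n l')"
  proof (rule similar_mat_diag_of_orthogonal_eigenvectors[of _ _ p])
    fix i m assume im: "i < n" "m < n"
    have "(\<Sum>j<n. (\<Sum>k<n. c k * p k i * p k j) * p m j) =
        (\<Sum>k<n. c k * p k i * (\<Sum>j<n. p k j * p m j))"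
      unfolding sum_distrib_right sum_distrib_left
      by (subst sum.swap) (simp add: mult.assoc)
    also have "\<dots> = (\<Sum>k<n. if k = m then c m * p m i * N m else 0)"
      using im orth by (intro sum.cong) (auto simp: N_def power2_eq_square)
    also have "\<dots> = (l' m - l m) * p m i"
      using im nonzero[of m] by (simp add: c_def N_def)
    finally show "(\<Sum>j<n. Y $$ (i, j) * p m j) = l' m * p m i"
      using im eigen[OF im] by (simp add: Y_def distrib_right sum.distrib algebra_simps)
  qed (use orth nonzero in \<open>auto simp: Y_def\<close>)
  ultimately show ?thesis by blast
qed

section \<open>A multiaffine inequality on the cube\<close>

lemma affine_nonneg_between_endpoints:
  fixes A B x :: real
  assumes "\<bar>x\<bar> \<le> 1" and "0 \<le> A + B" and "0 \<le> A - B"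
  shows "0 \<le> A + B * x"
proof -
  have "0 \<le> (1 + x) * (A + B)" "0 \<le> (1 - x) * (A - B)"
    using assms by simp_all
  then have "0 \<le> (1 + x) * (A + B) + (1 - x) * (A - B)"
    by (rule add_nonneg_nonneg)
  then show ?thesis
    by (simp add: algebra_simps)
qed

text \<open>
The inequalities $(1 \pm e)(1 \pm f) \ge 0$ with equal signs put $(1+ef,\, e+f)$ into the forward cone
$\{(m_0,m_1) : |m_1| \le m_0\}$ of the Minkowski plane, and two vectors of this cone have a
nonnegative Lorentz product.
\<close>

lemma lorentz_product_nonneg:
  fixes e f b d :: real
  assumes "\<bar>b\<bar> \<le> 1" "\<bar>d\<bar> \<le> 1" "\<bar>e\<bar> \<le> 1" "\<bar>f\<bar> \<le> 1"
  shows "(e + f) * (b + d) \<le> (1 + e * f) * (1 + b * d)"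
proof -
  have bound: "\<bar>x + y\<bar> \<le> 1 + x * y" if "\<bar>x\<bar> \<le> 1" "\<bar>y\<bar> \<le> 1" for x y :: real
  proof -
    have "0 \<le> (1 - x) * (1 - y)" "0 \<le> (1 + x) * (1 + y)"
      using that by (auto intro!: mult_nonneg_nonneg)
    then show ?thesis by (auto simp: algebra_simps)
  qed
  have "(e + f) * (b + d) \<le> \<bar>e + f\<bar> * \<bar>b + d\<bar>"
    using abs_ge_self[of "(e + f) * (b + d)"] by (simp add: abs_mult)
  also have "\<dots> \<le> (1 + e * f) * (1 + b * d)"
    using bound[OF assms(3,4)] bound[OF assms(1,2)] by (intro mult_mono) linarith+
  finally show ?thesis .
qed

text \<open>
Label the edges of the complete graph on four vertices such that \<open>a, c\<close> and \<open>b, d\<close> and \<open>e, f\<close> are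
the pairs of opposite edges. On the left stand the products over the four triangles; on the right,
besides the 1, those over the three 4-cycles. Everything is affine in each variable, and for
\<open>a = c = 1\<close> the difference of the two sides is the Lorentz product of $(1+ef,\, e+f)$ and
$(1+bd,\, b+d)$. The other signs of \<open>a\<close> and \<open>c\<close> reduce to this case, since changing the signs
of the three edges at a vertex changes neither side.
\<close>

lemma sum_triangles_le:
  fixes a b c d e f :: real
  assumes "\<bar>a\<bar> \<le> 1" "\<bar>b\<bar> \<le> 1" "\<bar>c\<bar> \<le> 1" "\<bar>d\<bar> \<le> 1" "\<bar>e\<bar> \<le> 1" "\<bar>f\<bar> \<le> 1"
  shows "a * b * e + a * d * f + b * c * f + c * d * e \<le>
    1 + (a * c) * (b * d) + (a * c) * (e * f) + (b * d) * (e * f)"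
proof -
  have corner: "0 \<le> (1 + e * f * (b * d) - b * e - d * f) + (e * f + b * d - b * f - d * e)"
    if "\<bar>b\<bar> \<le> 1" "\<bar>d\<bar> \<le> 1" "\<bar>e\<bar> \<le> 1" "\<bar>f\<bar> \<le> 1" for b d e f :: real
    using lorentz_product_nonneg[OF that] by (simp add: algebra_simps)
  \<comment> \<open>The face \<open>a = 1\<close>; its end \<open>c = -1\<close> is the corner with the signs at one vertex changed.\<close>
  have plus: "0 \<le> (1 + e * f * (b * d) - b * e - d * f) + (e * f + b * d - b * f - d * e) * c"
    if "\<bar>b\<bar> \<le> 1" "\<bar>d\<bar> \<le> 1" "\<bar>e\<bar> \<le> 1" "\<bar>f\<bar> \<le> 1" for b d e f :: real
    using corner[OF that] corner[of b "-d" e "-f"] that assms(3)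
    by (intro affine_nonneg_between_endpoints) (auto simp: algebra_simps)
  have "0 \<le> (1 + b * d * (e * f) - (b * f + d * e) * c) + (c * (b * d + e * f) - b * e - d * f) * a"
    using plus[of b d e f] plus[of "-b" d e "-f"] assms
    by (intro affine_nonneg_between_endpoints) (auto simp: algebra_simps)
  then show ?thesis
    by (simp add: algebra_simps)
qed

text \<open>
Rescaling the entries by \<open>sqrt (g i * g j)\<close> reduces this to the cube. Where \<open>g i = 0\<close> the entries of
the row vanish, and so do the quotients by Isabelle's convention for division by zero.
\<close>

lemma sum_triangles_le_homogeneous:
  fixes g :: "nat \<Rightarrow> real" and x :: "nat \<Rightarrow> nat \<Rightarrow> real"
  assumes g: "\<And>i. i < 4 \<Longrightarrow> 0 \<le> g i"
    and minor: "\<And>i j. i < j \<Longrightarrow> j < 4 \<Longrightarrow> (x i j)\<^sup>2 \<le> g i * g j"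
  shows "x 0 1 * x 1 2 * x 0 2 * g 3 + x 0 1 * x 1 3 * x 0 3 * g 2
      + x 0 2 * x 2 3 * x 0 3 * g 1 + x 1 2 * x 2 3 * x 1 3 * g 0 \<le>
    g 0 * g 1 * g 2 * g 3
      + (x 0 1 * x 2 3) * (x 0 2 * x 1 3) + (x 0 1 * x 2 3) * (x 0 3 * x 1 2)
      + (x 0 2 * x 1 3) * (x 0 3 * x 1 2)"
proof -
  define r where "r i = sqrt (g i)" for i
  define y where "y i j = x i j / (r i * r j)" for i j
  have r: "g i = r i * r i" if "i < 4" for i
    using g[OF that] by (simp add: r_def)
  have x: "x i j = y i j * (r i * r j)" and y: "\<bar>y i j\<bar> \<le> 1" if "i < j" "j < 4" for i j
  proof -
    have "\<bar>x i j\<bar> \<le> r i * r j"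
      using real_sqrt_le_mono[OF minor[OF that]] by (simp add: r_def real_sqrt_mult)
    then show "x i j = y i j * (r i * r j)" "\<bar>y i j\<bar> \<le> 1"
      by (auto simp: y_def abs_mult divide_le_eq)
  qed
  have "(y 0 1 * y 1 2 * y 0 2 + y 0 1 * y 0 3 * y 1 3 + y 1 2 * y 2 3 * y 1 3 + y 2 3 * y 0 3 * y 0 2)
        * (r 0 * r 1 * r 2 * r 3)\<^sup>2 \<le>
      (1 + (y 0 1 * y 2 3) * (y 1 2 * y 0 3) + (y 0 1 * y 2 3) * (y 0 2 * y 1 3)
         + (y 1 2 * y 0 3) * (y 0 2 * y 1 3)) * (r 0 * r 1 * r 2 * r 3)\<^sup>2"
    by (intro mult_right_mono sum_triangles_le y) auto
  then show ?thesis
    by (simp add: x r algebra_simps power2_eq_square)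
qed

section \<open>Trace, determinant and second moment\<close>

lemma det_3:
  fixes A :: "'a :: comm_ring_1 mat"
  assumes "A \<in> carrier_mat 3 3"
  shows "det A =
    A $$ (0,0) * (A $$ (1,1) * A $$ (2,2) - A $$ (1,2) * A $$ (2,1))
    - A $$ (0,1) * (A $$ (1,0) * A $$ (2,2) - A $$ (1,2) * A $$ (2,0))
    + A $$ (0,2) * (A $$ (1,0) * A $$ (2,1) - A $$ (1,1) * A $$ (2,0))"
proof -
  have det2: "det B = B $$ (0,0) * B $$ (1,1) - B $$ (0,1) * B $$ (1,0)"
    if "B \<in> carrier_mat 2 2" for B :: "'a mat"
    using that by (subst laplace_expansion_row[of _ 2 0])
      (auto simp: cofactor_def numeral_2_eq_2 mat_delete_def det_single)
  show ?thesis
    using assms by (subst laplace_expansion_row[of _ 3 0])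
      (auto simp: cofactor_def eval_nat_numeral mat_delete_def det2[unfolded numeral_2_eq_2] algebra_simps)
qed

text \<open>
The Leibniz sum grouped by cycle type: by symmetry a permutation and its inverse contribute equally,
whence the factors 2 for the 3-cycles (triangles) and the 4-cycles.
\<close>

lemma det_4_symmetric:
  fixes A :: "'a :: comm_ring_1 mat"
  assumes A: "A \<in> carrier_mat 4 4" and transpose: "transpose_mat A = A"
  shows "det A =
    A $$ (0,0) * A $$ (1,1) * A $$ (2,2) * A $$ (3,3)
    - (A $$ (0,1))\<^sup>2 * A $$ (2,2) * A $$ (3,3) - (A $$ (0,2))\<^sup>2 * A $$ (1,1) * A $$ (3,3)
    - (A $$ (0,3))\<^sup>2 * A $$ (1,1) * A $$ (2,2) - (A $$ (1,2))\<^sup>2 * A $$ (0,0) * A $$ (3,3)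
    - (A $$ (1,3))\<^sup>2 * A $$ (0,0) * A $$ (2,2) - (A $$ (2,3))\<^sup>2 * A $$ (0,0) * A $$ (1,1)
    + (A $$ (0,1) * A $$ (2,3))\<^sup>2 + (A $$ (0,2) * A $$ (1,3))\<^sup>2 + (A $$ (0,3) * A $$ (1,2))\<^sup>2
    + 2 * (A $$ (0,1) * A $$ (1,2) * A $$ (0,2) * A $$ (3,3)
         + A $$ (0,1) * A $$ (1,3) * A $$ (0,3) * A $$ (2,2)
         + A $$ (0,2) * A $$ (2,3) * A $$ (0,3) * A $$ (1,1)
         + A $$ (1,2) * A $$ (2,3) * A $$ (1,3) * A $$ (0,0))
    - 2 * ((A $$ (0,1) * A $$ (2,3)) * (A $$ (0,2) * A $$ (1,3))
         + (A $$ (0,1) * A $$ (2,3)) * (A $$ (0,3) * A $$ (1,2))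
         + (A $$ (0,2) * A $$ (1,3)) * (A $$ (0,3) * A $$ (1,2)))"
proof -
  have minor: "det (mat_delete A 0 j) =
      A $$ (1, k0) * (A $$ (2, k1) * A $$ (3, k2) - A $$ (2, k2) * A $$ (3, k1))
      - A $$ (1, k1) * (A $$ (2, k0) * A $$ (3, k2) - A $$ (2, k2) * A $$ (3, k0))
      + A $$ (1, k2) * (A $$ (2, k0) * A $$ (3, k1) - A $$ (2, k1) * A $$ (3, k0))"
    if "(j, k0, k1, k2) \<in> {(0,1,2,3), (1,0,2,3), (2,0,1,3), (3,0,1,2)}" for j k0 k1 k2
    using A that by (subst det_3) (auto simp: mat_delete_def eval_nat_numeral)
  have "det A = (\<Sum>j<4. A $$ (0, j) * cofactor A 0 j)"
    using A by (intro laplace_expansion_row) auto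
  also have "\<dots> = A $$ (0,0) * det (mat_delete A 0 0) - A $$ (0,1) * det (mat_delete A 0 1)
      + A $$ (0,2) * det (mat_delete A 0 2) - A $$ (0,3) * det (mat_delete A 0 3)"
    by (simp add: cofactor_def eval_nat_numeral)
  finally have expansion: "det A = A $$ (0,0) * det (mat_delete A 0 0)
      - A $$ (0,1) * det (mat_delete A 0 1)
      + A $$ (0,2) * det (mat_delete A 0 2) - A $$ (0,3) * det (mat_delete A 0 3)" .
  have sym: "A $$ (j, i) = A $$ (i, j)" if "i < 4" "j < 4" for i j
    using A transpose that by (metis carrier_matD index_transpose_mat(1))
  have lower: "A $$ (1,0) = A $$ (0,1)" "A $$ (2,0) = A $$ (0,2)" "A $$ (3,0) = A $$ (0,3)"
    "A $$ (2,1) = A $$ (1,2)" "A $$ (3,1) = A $$ (1,3)" "A $$ (3,2) = A $$ (2,3)"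
    by (rule sym; simp)+
  show ?thesis
    unfolding expansion lower minor[of 0 1 2 3, OF insertI1] minor[of 1 0 2 3, OF insertI2[OF insertI1]]
      minor[of 2 0 1 3, OF insertI2[OF insertI2[OF insertI1]]]
      minor[of 3 0 1 2, OF insertI2[OF insertI2[OF insertI2[OF insertI1]]]]
    by (simp only: power2_eq_square) (simp add: algebra_simps)
qed

lemma sum_diag_similar_mat_diag:
  fixes X :: "'a :: comm_ring_1 mat"
  assumes "X \<in> carrier_mat n n" and "similar_mat X (mat_diag n l)"
  shows "(\<Sum>i<n. X $$ (i, i)) = (\<Sum>k<n. l k)"
    and "(\<Sum>i<n. \<Sum>j<n. X $$ (i, j) * X $$ (j, i)) = (\<Sum>k<n. (l k)\<^sup>2)"
proof -
  obtain P Q where wit: "similar_mat_wit X (mat_diag n l) P Q"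
    using assms(2) unfolding similar_mat_def by blast
  note X = similar_mat_witD2(3)[OF assms(1) wit]
  note PQ = similar_mat_witD2(6,7,2)[OF assms(1) wit]
  have trace: "(\<Sum>i<n. (P * mat_diag n m * Q) $$ (i, i)) = (\<Sum>k<n. m k)" for m :: "nat \<Rightarrow> 'a"
  proof -
    have "(\<Sum>i<n. (P * mat_diag n m * Q) $$ (i, i)) = (\<Sum>i<n. \<Sum>k<n. P $$ (i, k) * m k * Q $$ (k, i))"
      using PQ by (simp add: mat_diag_mult_right[of _ n] scalar_prod_def atLeast0LessThan)
    also have "\<dots> = (\<Sum>k<n. m k * (Q * P) $$ (k, k))"
      using PQ(1,2) by (subst sum.swap)
        (simp add: scalar_prod_def atLeast0LessThan sum_distrib_left mult_ac)
    finally show ?thesis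
      using PQ(3) by simp
  qed
  show "(\<Sum>i<n. X $$ (i, i)) = (\<Sum>k<n. l k)"
    using trace X by simp
  have "X * X = X ^\<^sub>m 2"
    using assms(1) by (simp add: numeral_2_eq_2)
  also have "\<dots> = P * mat_diag n (\<lambda>k. (l k)\<^sup>2) * Q"
    unfolding similar_mat_wit_pow_id[OF wit]
    by (simp add: numeral_2_eq_2 left_mult_one_mat[OF mat_diag_dim])
  finally have "(\<Sum>i<n. (X * X) $$ (i, i)) = (\<Sum>k<n. (l k)\<^sup>2)"
    using trace by simp
  then show "(\<Sum>i<n. \<Sum>j<n. X $$ (i, j) * X $$ (j, i)) = (\<Sum>k<n. (l k)\<^sup>2)"
    using assms(1) by (simp add: scalar_prod_def atLeast0LessThan)
qed

section \<open>The necessary inequalities\<close>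

definition principal_minor_2 :: "real mat \<Rightarrow> nat \<Rightarrow> nat \<Rightarrow> real" where
  "principal_minor_2 X i j = X $$ (i, i) * X $$ (j, j) - (X $$ (i, j))\<^sup>2"

text \<open>
After expanding both sides, all terms containing the square of an off-diagonal entry
cancel. What remains is twice the inequality between triangles and 4-cycles.
\<close>

lemma det_le_sum_complementary_minors:
  assumes X: "X \<in> locally_psd_mats 4 2"
  shows "det X \<le> principal_minor_2 X 0 1 * principal_minor_2 X 2 3
    + principal_minor_2 X 0 2 * principal_minor_2 X 1 3
    + principal_minor_2 X 0 3 * principal_minor_2 X 1 2"
proof -
  have minors: "(X $$ (i, j))\<^sup>2 \<le> X $$ (i, i) * X $$ (j, j)"
    if "i < j" "j < 4" for i j
    using X that unfolding locally_psd_mats_2_iff by blast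
  have diag: "0 \<le> X $$ (i, i)" if "i < 4" for i
    using that by (intro locally_psd_diag_nonneg[OF X]) auto
  show ?thesis
    using sum_triangles_le_homogeneous[of "\<lambda>i. X $$ (i, i)" "\<lambda>i j. X $$ (i, j)", OF diag minors]
    unfolding det_4_symmetric[OF locally_psd_matsD(1,2)[OF X]] principal_minor_2_def
    by (simp add: algebra_simps power2_eq_square)
qed

text \<open>
Complementary minors enter through $4 d d' \le (d + d')^2$, and the sum of the three squares is at
most the square of the sum because the minors are nonnegative.
\<close>

lemma det_le_square_sum_minors:
  assumes X: "X \<in> locally_psd_mats 4 2"
  defines "e2 \<equiv> (\<Sum>j<4. \<Sum>i<j. principal_minor_2 X i j)"
  shows "0 \<le> e2" and "4 * det X \<le> e2\<^sup>2"
proof -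
  have nonneg: "0 \<le> principal_minor_2 X i j" if "i < j" "j < 4" for i j
    using X that unfolding locally_psd_mats_2_iff principal_minor_2_def by auto
  show "0 \<le> e2"
    unfolding e2_def by (intro sum_nonneg) (auto intro: nonneg)
  define a a' b b' c c' where "a = principal_minor_2 X 0 1" and "a' = principal_minor_2 X 2 3"
    and "b = principal_minor_2 X 0 2" and "b' = principal_minor_2 X 1 3"
    and "c = principal_minor_2 X 0 3" and "c' = principal_minor_2 X 1 2"
  note names = this
  have e2: "e2 = (a + a') + (b + b') + (c + c')"
    by (simp add: e2_def names eval_nat_numeral)
  have pos: "0 \<le> a + a'" "0 \<le> b + b'" "0 \<le> c + c'"
    by (auto simp: names intro!: add_nonneg_nonneg nonneg)
  have "det X \<le> a * a' + b * b' + c * c'"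
    using det_le_sum_complementary_minors[OF X] by (simp add: names)
  moreover have "4 * (x * y) \<le> (x + y)\<^sup>2" for x y :: real
    using zero_le_power2[of "x - y"] by (simp add: algebra_simps power2_eq_square)
  ultimately have "4 * det X \<le> (a + a')\<^sup>2 + (b + b')\<^sup>2 + (c + c')\<^sup>2"
    by (smt (verit, best))
  also have "\<dots> \<le> e2\<^sup>2"
    using mult_nonneg_nonneg[OF pos(1,2)] mult_nonneg_nonneg[OF pos(1,3)] mult_nonneg_nonneg[OF pos(2,3)]
    unfolding e2 by (simp add: algebra_simps power2_eq_square)
  finally show "4 * det X \<le> e2\<^sup>2" .
qed

text \<open>
Trace and sum of squared entries are invariant under the similarity, and together they determine the
second elementary symmetric function of the eigenvalues.
\<close>

lemma L_4_2_necessary: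
  assumes "(s, t) \<in> L_4_2"
  shows "0 \<le> 2 + s + t" and "0 \<le> 1 + 2 * s + 2 * t + s * t"
    and "4 * s * t \<le> (1 + 2 * s + 2 * t + s * t)\<^sup>2"
proof -
  obtain X where X: "X \<in> locally_psd_mats 4 2"
    and sim: "similar_mat X (mat_diag 4 (\<lambda>k. [1, 1, s, t] ! k))"
    using assms by (auto simp: L_4_2_iff)
  note carrier = locally_psd_matsD(1)[OF X] and sym = locally_psd_matsD(3)[OF X]
  have trace: "X $$ (0,0) + X $$ (1,1) + X $$ (2,2) + X $$ (3,3) = 2 + s + t"
    using sum_diag_similar_mat_diag(1)[OF carrier sim] by (simp add: eval_nat_numeral)
  have "0 \<le> X $$ (0,0) + X $$ (1,1) + X $$ (2,2) + X $$ (3,3)"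
    by (intro add_nonneg_nonneg locally_psd_diag_nonneg[OF X]) auto
  with trace show "0 \<le> 2 + s + t" by simp
  define e2 where "e2 = (\<Sum>j<4. \<Sum>i<j. principal_minor_2 X i j)"
  have "2 * e2 = (X $$ (0,0) + X $$ (1,1) + X $$ (2,2) + X $$ (3,3))\<^sup>2
      - (\<Sum>i<4. \<Sum>j<4. X $$ (i, j) * X $$ (j, i))"
    using sym[of 0 1] sym[of 0 2] sym[of 0 3] sym[of 1 2] sym[of 1 3] sym[of 2 3]
    by (simp add: e2_def principal_minor_2_def eval_nat_numeral algebra_simps)
  also have "\<dots> = 2 * (1 + 2 * s + 2 * t + s * t)"
    unfolding trace sum_diag_similar_mat_diag(2)[OF carrier sim]
    by (simp add: eval_nat_numeral algebra_simps)
  finally have e2: "e2 = 1 + 2 * s + 2 * t + s * t" by simp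
  have "det X = s * t"
    unfolding det_similar[OF sim] by (subst det_4_symmetric) (auto simp: mat_diag_def intro!: eq_matI)
  then show "0 \<le> 1 + 2 * s + 2 * t + s * t" "4 * s * t \<le> (1 + 2 * s + 2 * t + s * t)\<^sup>2"
    using det_le_square_sum_minors[OF X] unfolding e2_def[symmetric] e2 by simp_all
qed

section \<open>Realising the region\<close>

lemma L_4_2_swap:
  assumes "(s, t) \<in> L_4_2"
  shows "(t, s) \<in> L_4_2"
proof -
  have "similar_mat (mat_diag 4 (\<lambda>k. [1, 1, s, t] ! k)) (mat_diag 4 (\<lambda>k. [1, 1, t, s] ! k))"
    by (rule similar_mat_diag_of_orthogonal_eigenvectors
        [where p = "\<lambda>k i. if i = [0, 1, 3, 2] ! k then 1 else 0"])
      (auto simp: mat_diag_def less_Suc_eq eval_nat_numeral)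
  with assms show ?thesis
    unfolding L_4_2_iff using similar_mat_trans by blast
qed

text \<open>
The value \<open>u\<close> solves $1 + 2s + 2u + su = 0$, so all principal $2 \times 2$ minors of a locally
positive semidefinite matrix with the eigenvalues $1, 1, s, u$ have to vanish. The matrix used here is
$2 \operatorname{diag}(c^2, c^2, c^2, h^2) - v v^T$ with $v = (c, c, c, h)$. On the vectors orthogonal
to $v$ that are supported on the first three coordinates it acts as $2c^2$, so $c^2 = 1/2$ gives the
double eigenvalue $1$. The other two eigenvalues have the product $-2h^2$, which determines
$h = g / \sqrt 2$.
\<close>

lemma L_4_2_above_vanishing_minors:
  fixes s t u :: real
  assumes s: "0 \<le> s" and u: "(2 + s) * u = - (1 + 2 * s)" and "u \<le> t"
  shows "(s, t) \<in> L_4_2"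
proof -
  have "u \<le> 0"
    using s u by (smt (verit) mult_pos_pos)
  then have "0 \<le> - (s * u)"
    using s by (simp add: mult_nonneg_nonpos)
  define g where "g = sqrt (- (s * u))"
  have g: "g * g = - (s * u)"
    using \<open>0 \<le> - (s * u)\<close> by (simp add: g_def)
  let ?X = "mat_of_rows_list 4
    [[1/2, -1/2, -1/2, -g/2],
     [-1/2, 1/2, -1/2, -g/2],
     [-1/2, -1/2, 1/2, -g/2],
     [-g/2, -g/2, -g/2, g * g/2]]"
  let ?p = "\<lambda>k i. [[1, -1, 0, 0], [1, 1, -2, 0],
    [g, g, g, -(1 + 2 * s)], [1 + 2 * s, 1 + 2 * s, 1 + 2 * s, 3 * g]] ! k ! i"
  have "?X \<in> locally_psd_mats 4 2"
    unfolding locally_psd_mats_2_iff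
    by (auto simp: symmetric_real_mats_def mat_of_rows_list_def less_Suc_eq eval_nat_numeral
        intro!: eq_matI)
  moreover have "(\<Sum>i<4. ?p k i * ?p m i) = 0" if "k < 4" "m < 4" "k \<noteq> m" for k m
    using that by (auto simp: less_Suc_eq eval_nat_numeral algebra_simps)
  moreover have "(\<Sum>i<4. (?p k i)\<^sup>2) \<noteq> 0" if "k < 4" for k
  proof -
    have "0 < (1 + 2 * s)\<^sup>2" using s by simp
    then have "g\<^sup>2 + g\<^sup>2 + g\<^sup>2 + (- (1 + 2 * s))\<^sup>2 \<noteq> 0"
      "(1 + 2 * s)\<^sup>2 + (1 + 2 * s)\<^sup>2 + (1 + 2 * s)\<^sup>2 + (3 * g)\<^sup>2 \<noteq> 0"
      using zero_le_power2[of g] zero_le_power2[of "3 * g"]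
      unfolding power2_minus by linarith+
    then show ?thesis
      using that by (auto simp: less_Suc_eq lessThan_Suc numeral_eq_Suc)
  qed
  moreover have "(\<Sum>j<4. ?X $$ (i, j) * ?p k j) = [1, 1, s, u] ! k * ?p k i" if "i < 4" "k < 4" for i k
  proof -
    have su: "s * u = - 1 - 2 * s - 2 * u"
      using u by (simp add: algebra_simps)
    have gg: "g * g = 1 + 2 * s + 2 * u"
      using g su by simp
    have "- (g / 2) - g * (- 1 - 2 * s) / 2 = s * g"
      by (simp add: field_simps)
    moreover have "- ((1 + 2 * s) / 2) - 3 * (g * g) / 2 = u * (1 + 2 * s)"
      unfolding gg using su by (simp add: field_simps)
    moreover have "s * (g * g) + 2 * (g * g) = s * (1 + 2 * s)"
      unfolding gg using su by (simp add: field_simps)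
    moreover have "g * (g * g) = g * (1 + 2 * s + 2 * u)"
      unfolding gg ..
    ultimately show ?thesis
      using that
      by (auto simp: mat_of_rows_list_def less_Suc_eq eval_nat_numeral simp del: mult_cancel_left)
        (simp_all add: field_simps)
  qed
  moreover have "[1, 1, s, u] ! k \<le> [1, 1, s, t] ! k" if "k < 4" for k
    using that \<open>u \<le> t\<close> by (auto simp: less_Suc_eq eval_nat_numeral)
  ultimately show ?thesis
    unfolding L_4_2_iff
    by (rule locally_psd_raise_eigenvalues[of ?X 4 ?p "\<lambda>k. [1, 1, s, u] ! k" "\<lambda>k. [1, 1, s, t] ! k"])
qed

text \<open>
The matrix is $1 - W W^T$ where $W$ has the rows $(x,0)$, $(a,b)$, $(0,y)$, $(a,-b)$. The columns of
$W$ are orthogonal, so they are eigenvectors, and the orthogonal complement belongs to the double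
eigenvalue $1$. The numbers $x$ and $y$ are chosen such that the four minors of cyclically adjacent
indices vanish, and $2 \alpha \beta = 1$ makes the other two minors equal.
\<close>

lemma L_4_2_above_negative:
  fixes s t \<alpha> \<beta> :: real
  assumes \<alpha>: "1/2 \<le> \<alpha>" "\<alpha> \<le> 1" and \<beta>: "1/2 \<le> \<beta>" "\<beta> \<le> 1" and \<alpha>\<beta>: "2 * \<alpha> * \<beta> = 1"
    and s: "- 2 * (1 - \<alpha>)\<^sup>2 \<le> s" and t: "- 2 * (1 - \<beta>)\<^sup>2 \<le> t"
  shows "(s, t) \<in> L_4_2"
proof -
  define w where "w = \<alpha> + \<beta> - 1"
  define a where "a = sqrt (1 - \<alpha>)"
  define b where "b = sqrt (1 - \<beta>)"
  define x where "x = sqrt (2 * \<alpha> * w)"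
  define y where "y = sqrt (2 * \<beta> * w)"
  have w: "0 \<le> w"
    using \<alpha> \<beta> by (simp add: w_def)
  have aa: "a * a = 1 - \<alpha>" and bb: "b * b = 1 - \<beta>"
    and xx: "x * x = 2 * \<alpha> * w" and yy: "y * y = 2 * \<beta> * w"
    using \<alpha> \<beta> w by (simp_all add: a_def b_def x_def y_def)
  have \<alpha>w: "2 * \<alpha> * w = 2 * \<alpha> * \<alpha> + 1 - 2 * \<alpha>" and \<beta>w: "2 * \<beta> * w = 2 * \<beta> * \<beta> + 1 - 2 * \<beta>"
    using \<alpha>\<beta> by (simp_all add: w_def algebra_simps)
  let ?X = "mat_of_rows_list 4
    [[2 * \<alpha> * (1 - \<alpha>), - (x * a), 0, - (x * a)],
     [- (x * a), w, - (b * y), \<alpha> - \<beta>],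
     [0, - (b * y), 2 * \<beta> * (1 - \<beta>), b * y],
     [- (x * a), \<alpha> - \<beta>, b * y, w]]"
  let ?p = "\<lambda>k i. [[- 2 * a, x, 0, x], [0, y, - 2 * b, - y], [x, a, 0, a], [0, b, y, - b]] ! k ! i"
  have sq: "x * a * (x * a) = 2 * \<alpha> * (1 - \<alpha>) * w" "b * y * (b * y) = 2 * \<beta> * (1 - \<beta>) * w"
  proof -
    have "x * a * (x * a) = x * x * (a * a)" "b * y * (b * y) = y * y * (b * b)"
      by (simp_all add: mult_ac)
    then show "x * a * (x * a) = 2 * \<alpha> * (1 - \<alpha>) * w" "b * y * (b * y) = 2 * \<beta> * (1 - \<beta>) * w"
      unfolding aa bb xx yy by (simp_all add: mult_ac)
  qed
  have diag: "0 \<le> 2 * \<alpha> * (1 - \<alpha>)" "0 \<le> 2 * \<beta> * (1 - \<beta>)"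
    using \<alpha> \<beta> by simp_all
  have "w * w - (\<alpha> - \<beta>) * (\<alpha> - \<beta>) = (2 * \<alpha> - 1) * (2 * \<beta> - 1)"
    by (simp add: w_def algebra_simps)
  also have "0 \<le> \<dots>"
    using \<alpha> \<beta> by simp
  finally have "(\<alpha> - \<beta>) * (\<alpha> - \<beta>) \<le> w * w"
    by simp
  have pattern: "mat_of_rows_list 4
      [[d\<^sub>0, - e, 0, - e], [- e, d\<^sub>1, - h, v], [0, - h, d\<^sub>2, h], [- e, v, h, d\<^sub>1]] \<in> locally_psd_mats 4 2"
    if "0 \<le> d\<^sub>0" "0 \<le> d\<^sub>1" "0 \<le> d\<^sub>2" "e * e \<le> d\<^sub>0 * d\<^sub>1" "h * h \<le> d\<^sub>1 * d\<^sub>2" "h * h \<le> d\<^sub>2 * d\<^sub>1" "v * v \<le> d\<^sub>1 * d\<^sub>1"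
    for d\<^sub>0 d\<^sub>1 d\<^sub>2 e h v :: real
    unfolding locally_psd_mats_2_iff using that
    by (auto simp: symmetric_real_mats_def mat_of_rows_list_def less_Suc_eq eval_nat_numeral
        intro!: eq_matI)
  have "?X \<in> locally_psd_mats 4 2"
    using diag w sq \<open>(\<alpha> - \<beta>) * (\<alpha> - \<beta>) \<le> w * w\<close> by (intro pattern) (simp_all add: mult.commute)
  moreover have "(\<Sum>i<4. ?p k i * ?p m i) = 0" if "k < 4" "m < 4" "k \<noteq> m" for k m
    using that by (auto simp: less_Suc_eq eval_nat_numeral algebra_simps)
  moreover have "(\<Sum>i<4. (?p k i)\<^sup>2) \<noteq> 0" if "k < 4" for k
  proof -
    have "0 < x * x + 2 * (a * a)" "0 < y * y + 2 * (b * b)"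
      using zero_le_power2[of "1 - \<alpha>"] zero_le_power2[of "1 - \<beta>"]
      unfolding aa bb xx yy \<alpha>w \<beta>w by (simp_all add: power2_eq_square algebra_simps)
    then show ?thesis
      using that by (auto simp: less_Suc_eq lessThan_Suc numeral_eq_Suc)
  qed
  moreover have "(\<Sum>j<4. ?X $$ (i, j) * ?p k j) =
      [1, 1, - 2 * (1 - \<alpha>)\<^sup>2, - 2 * (1 - \<beta>)\<^sup>2] ! k * ?p k i" if "i < 4" "k < 4" for i k
  proof -
    have "a * (x * x) = a * (2 * \<alpha> * \<alpha> + 1 - 2 * \<alpha>)" "b * (y * y) = b * (2 * \<beta> * \<beta> + 1 - 2 * \<beta>)"
      "x * (a * a) = x * (1 - \<alpha>)" "y * (b * b) = y * (1 - \<beta>)"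
      by (simp_all add: aa bb xx yy \<alpha>w \<beta>w)
    note cubic = this
    show ?thesis
      using that
      by (auto simp: mat_of_rows_list_def less_Suc_eq eval_nat_numeral simp del: mult_cancel_left)
        (use cubic in \<open>simp_all add: w_def algebra_simps\<close>)
  qed
  moreover have "[1, 1, - 2 * (1 - \<alpha>)\<^sup>2, - 2 * (1 - \<beta>)\<^sup>2] ! k \<le> [1, 1, s, t] ! k" if "k < 4" for k
    using that s t by (auto simp: less_Suc_eq numeral_eq_Suc)
  ultimately show ?thesis
    unfolding L_4_2_iff
    by (rule locally_psd_raise_eigenvalues[of ?X 4 ?p
          "\<lambda>k. [1, 1, - 2 * (1 - \<alpha>)\<^sup>2, - 2 * (1 - \<beta>)\<^sup>2] ! k" "\<lambda>k. [1, 1, s, t] ! k"])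
qed

theorem corollary2p7:
  shows "L_4_2 =
    {(s, t). 2 + s + t \<ge> 0 \<and>
             1 + 2 * s + 2 * t + s * t \<ge> 0 \<and>
             (1 + 2 * s + 2 * t + s * t)\<^sup>2 \<ge> 4 * s * t}"
proof (intro equalityI subrelI)
  fix s t assume "(s, t) \<in> L_4_2"
  then show "(s, t) \<in> {(s, t). 2 + s + t \<ge> 0 \<and> 1 + 2 * s + 2 * t + s * t \<ge> 0 \<and>
      (1 + 2 * s + 2 * t + s * t)\<^sup>2 \<ge> 4 * s * t}"
    using L_4_2_necessary by blast
next
  fix s t :: real
  assume "(s, t) \<in> {(s, t). 2 + s + t \<ge> 0 \<and> 1 + 2 * s + 2 * t + s * t \<ge> 0 \<and>
      (1 + 2 * s + 2 * t + s * t)\<^sup>2 \<ge> 4 * s * t}"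
  then have trace: "0 \<le> 2 + s + t" and e2: "0 \<le> 1 + 2 * s + 2 * t + s * t"
    and det: "4 * s * t \<le> (1 + 2 * s + 2 * t + s * t)\<^sup>2"
    by auto
  have opposite: "(s, t) \<in> L_4_2" if "0 \<le> s" "0 \<le> 1 + 2 * s + 2 * t + s * t" for s t :: real
  proof (rule L_4_2_above_vanishing_minors[OF \<open>0 \<le> s\<close>])
    show "(2 + s) * (- (1 + 2 * s) / (2 + s)) = - (1 + 2 * s)"
      using that by simp
    show "- (1 + 2 * s) / (2 + s) \<le> t"
      using that by (simp add: divide_le_eq algebra_simps)
  qed
  consider "0 \<le> s" | "0 \<le> t" | "s < 0" "t < 0" by linarith
  then show "(s, t) \<in> L_4_2"
  proof cases
    case 1
    then show ?thesis using e2 by (rule opposite)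
  next
    case 2
    have "(t, s) \<in> L_4_2"
      using 2 e2 by (intro opposite) (simp_all add: algebra_simps)
    then show ?thesis by (rule L_4_2_swap)
  next
    case 3
    define p where "p = sqrt (- s)"
    define q where "q = sqrt (- t)"
    have p: "s = - p\<^sup>2" "0 < p" and q: "t = - q\<^sup>2" "0 < q"
      using 3 by (simp_all add: p_def q_def)
    have "(2 * (p * q))\<^sup>2 \<le> (1 + 2 * s + 2 * t + s * t)\<^sup>2"
      using det by (simp add: p q power2_eq_square mult_ac)
    then have "2 * (p * q) \<le> 1 + 2 * s + 2 * t + s * t"
      using e2 by (rule power2_le_imp_le)
    then have "2 * (p + q)\<^sup>2 \<le> (1 + p * q)\<^sup>2"
      by (simp add: p q power2_eq_square algebra_simps)
    then have "(sqrt 2 * (p + q))\<^sup>2 \<le> (1 + p * q)\<^sup>2"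
      by (simp add: power_mult_distrib)
    then have "sqrt 2 * (p + q) \<le> 1 + p * q"
      by (rule power2_le_imp_le) (use p q in simp)
    then have product: "1 \<le> (sqrt 2 - p) * (sqrt 2 - q)"
      by (simp add: algebra_simps)
    have "p < sqrt 2"
    proof (rule ccontr)
      assume "\<not> p < sqrt 2"
      then have "(sqrt 2)\<^sup>2 \<le> p\<^sup>2"
        by (intro power_mono) auto
      moreover have "0 < q\<^sup>2"
        using q by simp
      ultimately show False
        using trace p(1) q(1) by simp
    qed
    \<comment> \<open>The point \<open>(s, t)\<close> lies straight above the boundary point with the same first coordinate.\<close>
    define \<alpha> where "\<alpha> = 1 - p / sqrt 2"
    define \<beta> where "\<beta> = 1 / (2 * \<alpha>)"
    have "0 < \<alpha>" "\<alpha> \<le> 1"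
      using \<open>p < sqrt 2\<close> p by (simp_all add: \<alpha>_def)
    have "\<alpha> * (1 - q / sqrt 2) \<ge> 1 / 2"
      using product by (simp add: \<alpha>_def field_simps)
    then have \<beta>: "\<beta> \<le> 1 - q / sqrt 2"
      using \<open>0 < \<alpha>\<close> by (simp add: \<beta>_def field_simps)
    then have "\<beta> \<le> 1"
      using q by (smt (verit) divide_nonneg_nonneg real_sqrt_ge_zero)
    show ?thesis
    proof (rule L_4_2_above_negative[of \<alpha> \<beta>])
      show "1/2 \<le> \<alpha>" "1/2 \<le> \<beta>" "2 * \<alpha> * \<beta> = 1"
        using \<open>0 < \<alpha>\<close> \<open>\<alpha> \<le> 1\<close> \<open>\<beta> \<le> 1\<close> by (simp_all add: \<beta>_def field_simps)
      show "- 2 * (1 - \<alpha>)\<^sup>2 \<le> s"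
        by (simp add: \<alpha>_def p power_divide)
      have "(q / sqrt 2)\<^sup>2 \<le> (1 - \<beta>)\<^sup>2"
        using \<beta> q by (intro power_mono) auto
      then show "- 2 * (1 - \<beta>)\<^sup>2 \<le> t"
        by (simp add: q power_divide)
    qed fact+
  qed
qed

end
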